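(* Let $A$ be a point configuration with $n$ points, and let $H$ be a subgroup of the automorphism group $\operatorname{Aut}(V(A))\le\mathrm{Sym}(n)$ of the vertices $V(A)$ of $A$. Let $T$ be a non-empty subset of (indices of) pairwise $H$-properly intersecting $H$-feasible simplices whose set of free interior facets is empty. Then $T$ indexes an $H$-invariant triangulation of $A$.
   Context: $A$ is given by a real $r\times n$ matrix of rank $r$ whose columns $a_1,\dots,a_n$ are the points in homogeneous coordinates. A circuit is an inclusion-minimal linearly dependent set $C$ of column indices; a circuit signature splits $C=C_+\cup C_-$ such that $\sum_{i\in C_+}\lambda_ia_i=\sum_{i\in C_-}\lambda_ia_i$ for some $\lambda_i>0$, and $(C_+,C_-)$ is a signed circuit (each circuit yields two opposite ones). A cocircuit is an inclusion-maximal index set $C_0^*$ with $\operatorname{rank}(A_{C_0^*})<r$; with a non-zero $c\in\mathbb{R}^r$ satisfying $c^\top a_i=0$ exactly for $i\in C_0^*$ put $C_\pm^*=\{i:\pm c^\top a_i>0\}$; $(C_+^*,C_-^* )$ is a signed cocircuit. A (combinatorial) automorphism (symmetry) of a configuration is a permutation of its elements mapping signed circuits to signed circuits in both directions (equivalently for signed cocircuits). A simplex is an index set $S$ of size $r$ with $\operatorname{rank}(A_S)=r$; its facets are its $(r-1)$-subsets. Two simplices $S_1,S_2$ intersect properly if there is no signed circuit with $C_+\subseteq S_1$ and $C_-\subseteq S_2$. A simplex facet $F$ is interior if there is a cocircuit $C_0^*\supseteq F$ with $C_+^*$ and $C_-^*$ both non-empty. A triangulation is a non-empty set $\mathcal{T}$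 of pairwise properly intersecting simplices such that for each interior facet $F$ of some $S\in\mathcal{T}$ there is another $S'\in\mathcal{T}$ containing $F$. Simplices are numbered (indexed) by integers, and sets $T$ of indices are identified with the corresponding sets of simplices; permutations of the points act on index sets of points, hence on simplices and sets of simplices. The set of free interior facets of $T$ is the set of interior simplex facets contained in exactly one simplex of $T$. An index $s$ indexes an $H$-feasible simplex if any two elements of the $H$-orbit of $s$ index identical or properly intersecting simplices. Two indices $s,s'$ intersect $H$-properly if any two elements from (the union of) their respective $H$-orbits index identical or properly intersecting simplices. A triangulation indexed by $T$ is $H$-invariant if $\sigma(T)=T$ for all $\sigma\in H$. *)

theory Defs
  imports "HOL-Analysis.Analysis" "HOL-Algebra.Bij"
begin

text \<open>
  A configuration is an \<open>r \<times> n\<close> matrix \<open>A :: real ^ 'n ^ 'r\<close> with \<open>r = CARD('r)\<close> and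
  \<open>n = CARD('n)\<close>; its elements are the column indices, so that repeated points are allowed.
  The normalising homogeneous coordinate may be any of the rows.
\<close>

definition point_configuration :: "real ^ 'n::finite ^ 'r::finite \<Rightarrow> bool" where
  "point_configuration A \<longleftrightarrow> rank A = CARD('r) \<and> (\<exists>k. \<forall>i. A $ k $ i = 1)"

definition subrank :: "real ^ 'n::finite ^ 'r::finite \<Rightarrow> 'n set \<Rightarrow> nat" where
  "subrank A I = dim ((\<lambda>i. column i A) ` I)"

text \<open>
  Linear dependence refers to the family of columns indexed by \<open>I\<close>: two equal columns with
  different indices are dependent, which \<^const>\<open>dependent\<close> on the set of columns would miss.
\<close>

definition cols_dependent :: "real ^ 'n::finite ^ 'r::finite \<Rightarrow> 'n set \<Rightarrow> bool" where
  "cols_dependent A I \<longleftrightarrow>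
     (\<exists>l. (\<exists>i\<in>I. l i \<noteq> 0) \<and> (\<Sum>i\<in>I. l i *\<^sub>R column i A) = 0)"

definition circuit :: "real ^ 'n::finite ^ 'r::finite \<Rightarrow> 'n set \<Rightarrow> bool" where
  "circuit A C \<longleftrightarrow> cols_dependent A C \<and> (\<forall>D. D \<subset> C \<longrightarrow> \<not> cols_dependent A D)"

definition signed_circuit :: "real ^ 'n::finite ^ 'r::finite \<Rightarrow> 'n set \<Rightarrow> 'n set \<Rightarrow> bool" where
  "signed_circuit A Cp Cm \<longleftrightarrow>
     circuit A (Cp \<union> Cm) \<and> Cp \<inter> Cm = {} \<and>
     (\<exists>l. (\<forall>i\<in>Cp \<union> Cm. l i > 0) \<and>
          (\<Sum>i\<in>Cp. l i *\<^sub>R column i A) = (\<Sum>i\<in>Cm. l i *\<^sub>R column i A))"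

definition cocircuit :: "real ^ 'n::finite ^ 'r::finite \<Rightarrow> 'n set \<Rightarrow> bool" where
  "cocircuit A Z \<longleftrightarrow>
     subrank A Z < CARD('r) \<and> (\<forall>Z'. Z \<subset> Z' \<longrightarrow> \<not> subrank A Z' < CARD('r))"

definition signed_cocircuit ::
    "real ^ 'n::finite ^ 'r::finite \<Rightarrow> 'n set \<Rightarrow> 'n set \<Rightarrow> 'n set \<Rightarrow> bool" where
  "signed_cocircuit A Z Cp Cm \<longleftrightarrow>
     cocircuit A Z \<and>
     (\<exists>c. c \<noteq> 0 \<and> (\<forall>i. c \<bullet> column i A = 0 \<longleftrightarrow> i \<in> Z) \<and>
          Cp = {i. c \<bullet> column i A > 0} \<and> Cm = {i. - (c \<bullet> column i A) > 0})"

definition is_simplex :: "real ^ 'n::finite ^ 'r::finite \<Rightarrow> 'n set \<Rightarrow> bool" where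
  "is_simplex A S \<longleftrightarrow> card S = CARD('r) \<and> subrank A S = CARD('r)"

definition facet_of_simplex ::
    "real ^ 'n::finite ^ 'r::finite \<Rightarrow> 'n set \<Rightarrow> 'n set \<Rightarrow> bool" where
  "facet_of_simplex A F S \<longleftrightarrow> is_simplex A S \<and> F \<subseteq> S \<and> card F = CARD('r) - 1"

definition intersect_properly ::
    "real ^ 'n::finite ^ 'r::finite \<Rightarrow> 'n set \<Rightarrow> 'n set \<Rightarrow> bool" where
  "intersect_properly A S1 S2 \<longleftrightarrow>
     \<not> (\<exists>Cp Cm. signed_circuit A Cp Cm \<and> Cp \<subseteq> S1 \<and> Cm \<subseteq> S2)"

definition interior_facet :: "real ^ 'n::finite ^ 'r::finite \<Rightarrow> 'n set \<Rightarrow> bool" where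
  "interior_facet A F \<longleftrightarrow>
     (\<exists>S. facet_of_simplex A F S) \<and>
     (\<exists>Z Cp Cm. signed_cocircuit A Z Cp Cm \<and> F \<subseteq> Z \<and> Cp \<noteq> {} \<and> Cm \<noteq> {})"

definition is_triangulation :: "real ^ 'n::finite ^ 'r::finite \<Rightarrow> 'n set set \<Rightarrow> bool" where
  "is_triangulation A T \<longleftrightarrow>
     T \<noteq> {} \<and> (\<forall>S\<in>T. is_simplex A S) \<and> pairwise (intersect_properly A) T \<and>
     (\<forall>S\<in>T. \<forall>F. facet_of_simplex A F S \<and> interior_facet A F \<longrightarrow>
        (\<exists>S'\<in>T. S' \<noteq> S \<and> F \<subseteq> S'))"

definition free_interior_facets ::
    "real ^ 'n::finite ^ 'r::finite \<Rightarrow> 'n set set \<Rightarrow> 'n set set" where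
  "free_interior_facets A T = {F. interior_facet A F \<and> (\<exists>!S. S \<in> T \<and> F \<subseteq> S)}"

definition automorphisms :: "real ^ 'n::finite ^ 'r::finite \<Rightarrow> ('n \<Rightarrow> 'n) set" where
  "automorphisms A =
     {\<sigma>. bij \<sigma> \<and> (\<forall>Cp Cm. signed_circuit A (\<sigma> ` Cp) (\<sigma> ` Cm) \<longleftrightarrow> signed_circuit A Cp Cm)}"

definition aut_group :: "real ^ 'n::finite ^ 'r::finite \<Rightarrow> ('n \<Rightarrow> 'n) monoid" where
  "aut_group A = (BijGroup UNIV)\<lparr>carrier := automorphisms A\<rparr>"

lemma automorphisms_subgroup: "subgroup (automorphisms A) (BijGroup UNIV)"
proof (rule group.subgroupI[OF group_BijGroup])
  show "automorphisms A \<subseteq> carrier (BijGroup UNIV)"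
    by (auto simp: automorphisms_def BijGroup_def Bij_def extensional_def)
  have "id \<in> automorphisms A"
    by (simp add: automorphisms_def)
  then show "automorphisms A \<noteq> {}" by blast
next
  fix f assume f: "f \<in> automorphisms A"
  then have b: "bij f" by (simp add: automorphisms_def)
  then have eq: "f ` (inv_into UNIV f ` X) = X" for X
    by (simp add: image_f_inv_f bij_is_surj)
  have "signed_circuit A (inv_into UNIV f ` P) (inv_into UNIV f ` N) \<longleftrightarrow> signed_circuit A P N" for P N
  proof -
    have "signed_circuit A (f ` (inv_into UNIV f ` P)) (f ` (inv_into UNIV f ` N)) \<longleftrightarrow>
          signed_circuit A (inv_into UNIV f ` P) (inv_into UNIV f ` N)"
      using f unfolding automorphisms_def by blast
    then show ?thesis by (simp only: eq)
  qed
  then have "inv_into UNIV f \<in> automorphisms A"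
    using b by (simp add: automorphisms_def bij_imp_bij_inv)
  moreover have "inv\<^bsub>BijGroup UNIV\<^esub> f = inv_into UNIV f"
    using b by (subst inv_BijGroup) (auto simp: Bij_def extensional_def)
  ultimately show "inv\<^bsub>BijGroup UNIV\<^esub> f \<in> automorphisms A" by simp
next
  fix f g assume fg: "f \<in> automorphisms A" "g \<in> automorphisms A"
  then have "f \<circ> g \<in> automorphisms A"
    unfolding automorphisms_def by (auto intro: bij_comp simp only: image_comp[symmetric] mem_Collect_eq)
  moreover have "f \<otimes>\<^bsub>BijGroup UNIV\<^esub> g = f \<circ> g"
    using fg by (simp add: automorphisms_def BijGroup_def Bij_def extensional_def compose_def
        restrict_def comp_def)
  ultimately show "f \<otimes>\<^bsub>BijGroup UNIV\<^esub> g \<in> automorphisms A" by simp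
qed

lemma group_aut_group: "group (aut_group A)"
  unfolding aut_group_def
  by (rule subgroup.subgroup_is_group[OF automorphisms_subgroup group_BijGroup])

definition simplex_orbit :: "('n \<Rightarrow> 'n) set \<Rightarrow> 'n set \<Rightarrow> 'n set set" where
  "simplex_orbit H S = (\<lambda>\<sigma>. \<sigma> ` S) ` H"

text \<open>
  Simplices are identified with their integer indices.  Automorphisms map simplices to
  simplices, so it suffices to require this of \<open>S\<close> itself.
\<close>

definition feasible ::
    "real ^ 'n::finite ^ 'r::finite \<Rightarrow> ('n \<Rightarrow> 'n) set \<Rightarrow> 'n set \<Rightarrow> bool" where
  "feasible A H S \<longleftrightarrow>
     is_simplex A S \<and>
     (\<forall>S1\<in>simplex_orbit H S. \<forall>S2\<in>simplex_orbit H S. S1 = S2 \<or> intersect_properly A S1 S2)"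

definition orbits_intersect_properly ::
    "real ^ 'n::finite ^ 'r::finite \<Rightarrow> ('n \<Rightarrow> 'n) set \<Rightarrow> 'n set \<Rightarrow> 'n set \<Rightarrow> bool" where
  "orbits_intersect_properly A H S S' \<longleftrightarrow>
     (\<forall>S1\<in>simplex_orbit H S \<union> simplex_orbit H S'.
      \<forall>S2\<in>simplex_orbit H S \<union> simplex_orbit H S'. S1 = S2 \<or> intersect_properly A S1 S2)"

definition invariant :: "('n \<Rightarrow> 'n) set \<Rightarrow> 'n set set \<Rightarrow> bool" where
  "invariant H T \<longleftrightarrow> (\<forall>\<sigma>\<in>H. (\<lambda>S. \<sigma> ` S) ` T = T)"

end

theory Submission
  imports Defs
begin

text \<open>
  Only invariance needs an argument. For \<open>\<sigma> \<in> H\<close> and \<open>S \<in> T\<close> the simplex \<open>\<sigma> ` S\<close> intersects every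
  member of \<open>T\<close> properly or is equal to it, so it suffices that a triangulation is maximal among
  sets of properly intersecting simplices. Join a point \<open>y\<close> in the open cone of some member of \<open>T\<close>
  to a generic point \<open>x\<close> in the open cone of \<open>\<sigma> ` S\<close> by a segment that avoids all cones of codimension
  two. The segment can leave the cones of \<open>T\<close> only through the relative interior of a facet. That
  facet is interior, as otherwise \<open>x\<close> and \<open>y\<close> both lie strictly on one side of it, and the adjacent
  simplex of \<open>T\<close> continues the cover on the other side. Hence \<open>x\<close> lies in the cone of a member of
  \<open>T\<close>; the two non-negative representations of \<open>x\<close> agree, because their difference would
  contain a circuit violating proper intersection, and so the two simplices coincide.
\<close>

section \<open>Signed circuits inside linear dependencies\<close>

text \<open>Links geometry to combinatorics: cone arguments produce arbitrary dependencies, whereas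
  proper intersection and automorphisms speak of signed circuits only. A support that is not a
  circuit shrinks by subtracting a multiple of a dependency on a smaller set, without reversing any
  sign.\<close>

lemma conformal_circuit:
  fixes A :: "real ^ 'n::finite ^ 'r::finite"
  assumes dep: "(\<Sum>i\<in>UNIV. l i *\<^sub>R column i A) = 0" and nz: "l i0 \<noteq> 0"
  shows "\<exists>Cp Cm. signed_circuit A Cp Cm \<and> Cp \<subseteq> {i. l i > 0} \<and> Cm \<subseteq> {i. l i < 0}"
proof -
  \<comment> \<open>Among the dependencies conformal to \<open>l\<close>, one of minimal support is supported on a circuit.\<close>
  define P where "P m \<longleftrightarrow> (\<Sum>i\<in>UNIV. m i *\<^sub>R column i A) = 0 \<and> (\<exists>i. m i \<noteq> 0) \<and>
      (\<forall>i. (m i > 0 \<longrightarrow> l i > 0) \<and> (m i < 0 \<longrightarrow> l i < 0))" for m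
  have "P l" using dep nz by (auto simp: P_def)
  then obtain m where Pm: "P m" and least: "\<And>k. P k \<Longrightarrow> card {i. m i \<noteq> 0} \<le> card {i. k i \<noteq> 0}"
    using ex_has_least_nat[of P l "\<lambda>m. card {i. m i \<noteq> 0}"] by blast
  define C where "C = {i. m i \<noteq> 0}"
  have msum: "(\<Sum>i\<in>UNIV. m i *\<^sub>R column i A) = 0" using Pm by (simp add: P_def)
  have "(\<Sum>i\<in>C. m i *\<^sub>R column i A) = (\<Sum>i\<in>UNIV. m i *\<^sub>R column i A)"
    by (rule sum.mono_neutral_left) (auto simp: C_def)
  then have depC: "cols_dependent A C"
    using Pm unfolding cols_dependent_def P_def C_def by (intro exI[of _ m]) auto
  have "\<not> cols_dependent A D" if D: "D \<subset> C" for D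
  proof
    assume "cols_dependent A D"
    then obtain d0 where d0: "\<exists>i\<in>D. d0 i \<noteq> 0" "(\<Sum>i\<in>D. d0 i *\<^sub>R column i A) = 0"
      by (auto simp: cols_dependent_def)
    then obtain i1 where i1: "i1 \<in> D" "d0 i1 \<noteq> 0" by blast
    \<comment> \<open>The sign factor makes \<open>d\<close> agree in sign with \<open>m\<close> at
      \<open>i1\<close>, so that the set \<open>I\<close> below is non-empty.\<close>
    define d where "d i = (if i \<in> D then sgn (m i1 * d0 i1) * d0 i else 0)" for i
    have "(\<Sum>i\<in>UNIV. d i *\<^sub>R column i A) = (\<Sum>i\<in>D. d i *\<^sub>R column i A)"
      by (rule sum.mono_neutral_right) (auto simp: d_def)
    also have "\<dots> = sgn (m i1 * d0 i1) *\<^sub>R (\<Sum>i\<in>D. d0 i *\<^sub>R column i A)"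
      by (simp add: d_def scaleR_sum_right)
    finally have dsum: "(\<Sum>i\<in>UNIV. d i *\<^sub>R column i A) = 0" using d0 by simp
    have "m i1 \<noteq> 0" using i1 D by (auto simp: C_def)
    then have di1: "m i1 * d i1 > 0"
      using i1 by (auto simp: d_def sgn_if zero_less_mult_iff mult_less_0_iff)
    define I where "I = {i. m i * d i > 0}"
    \<comment> \<open>The largest multiple of \<open>d\<close> that can be subtracted from
      \<open>m\<close> before a coefficient changes sign; the coefficient at the minimiser
      \<open>i2\<close> becomes zero.\<close>
    define t where "t = Min ((\<lambda>i. m i / d i) ` I)"
    have fin: "finite ((\<lambda>i. m i / d i) ` I)" and ne: "(\<lambda>i. m i / d i) ` I \<noteq> {}"
      using di1 by (auto simp: I_def)
    from Min_in[OF fin ne] obtain i2 where i2: "i2 \<in> I" "t = m i2 / d i2"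
      by (auto simp: t_def)
    have tpos: "t > 0" using i2 by (auto simp: I_def zero_less_mult_iff zero_less_divide_iff)
    have tle: "t \<le> m i / d i" if "i \<in> I" for i
      using that fin by (auto simp: t_def)
    define k where "k i = m i - t * d i" for i
    have ksum: "(\<Sum>i\<in>UNIV. k i *\<^sub>R column i A) = 0"
    proof -
      have "(\<Sum>i\<in>UNIV. k i *\<^sub>R column i A) =
          (\<Sum>i\<in>UNIV. m i *\<^sub>R column i A) - t *\<^sub>R (\<Sum>i\<in>UNIV. d i *\<^sub>R column i A)"
        by (simp add: k_def scaleR_left_diff_distrib sum_subtractf scaleR_sum_right)
      then show ?thesis using msum dsum by simp
    qed
    have m0: "k i = 0" if "m i = 0" for i
      using that D by (auto simp: k_def d_def C_def)
    \<comment> \<open>On \<open>I\<close> the bound by \<open>t\<close> prevents a sign change; off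
      \<open>I\<close> the subtraction never moves a non-zero coefficient towards zero.\<close>
    have sgnk: "(k i > 0 \<longrightarrow> m i > 0) \<and> (k i < 0 \<longrightarrow> m i < 0)" for i
    proof (cases "i \<in> I")
      case True
      then have "t \<le> m i / d i" "m i * d i > 0" using tle by (auto simp: I_def)
      then consider "d i > 0" "m i > 0" "t * d i \<le> m i" | "d i < 0" "m i < 0" "m i \<le> t * d i"
        by (auto simp: zero_less_mult_iff pos_le_divide_eq neg_le_divide_eq)
      then show ?thesis by cases (auto simp: k_def)
    next
      case False
      then have le: "m i * d i \<le> 0" by (simp add: I_def)
      consider "m i = 0" | "m i > 0" "d i \<le> 0" | "m i < 0" "d i \<ge> 0"
        using le by (cases "m i" "0::real" rule: linorder_cases) (auto simp: mult_le_0_iff)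
      then show ?thesis
      proof cases
        case 2
        then have "t * d i \<le> 0" using tpos by (simp add: mult_le_0_iff)
        then show ?thesis using 2 by (simp add: k_def)
      next
        case 3
        then have "t * d i \<ge> 0" using tpos by simp
        then show ?thesis using 3 by (simp add: k_def)
      qed (simp add: m0)
    qed
    \<comment> \<open>Since \<open>d\<close> vanishes outside \<open>D\<close>, an index of
      \<open>C\<close> outside \<open>D\<close> keeps its coefficient, so \<open>k\<close> is not
      the zero dependency.\<close>
    obtain i3 where i3: "i3 \<in> C" "i3 \<notin> D" using D by blast
    then have "k i3 \<noteq> 0" by (simp add: k_def d_def C_def)
    with ksum sgnk Pm have "P k" unfolding P_def by blast
    from least[OF this] have le: "card C \<le> card {i. k i \<noteq> 0}" by (simp add: C_def)
    have "k i2 = 0" "m i2 \<noteq> 0" using i2 by (auto simp: k_def I_def)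
    then have "{i. k i \<noteq> 0} \<subset> C" using m0 by (auto simp: C_def)
    then have "card {i. k i \<noteq> 0} < card C" by (intro psubset_card_mono) auto
    with le show False by simp
  qed
  with depC have circ: "circuit A C" by (simp add: circuit_def)
  define Cp where "Cp = {i. m i > 0}"
  define Cm where "Cm = {i. m i < 0}"
  have "C = Cp \<union> Cm" "Cp \<inter> Cm = {}" by (auto simp: C_def Cp_def Cm_def)
  moreover have "(\<Sum>i\<in>Cp. \<bar>m i\<bar> *\<^sub>R column i A) = (\<Sum>i\<in>Cm. \<bar>m i\<bar> *\<^sub>R column i A)"
  proof -
    have "0 = (\<Sum>i\<in>C. m i *\<^sub>R column i A)"
      using msum sum.mono_neutral_left[of UNIV C "\<lambda>i. m i *\<^sub>R column i A"] by (auto simp: C_def)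
    also have "\<dots> = (\<Sum>i\<in>Cp. m i *\<^sub>R column i A) + (\<Sum>i\<in>Cm. m i *\<^sub>R column i A)"
      unfolding \<open>C = Cp \<union> Cm\<close> using \<open>Cp \<inter> Cm = {}\<close> by (intro sum.union_disjoint) auto
    also have "(\<Sum>i\<in>Cp. m i *\<^sub>R column i A) = (\<Sum>i\<in>Cp. \<bar>m i\<bar> *\<^sub>R column i A)"
      by (intro sum.cong) (auto simp: Cp_def)
    also have "(\<Sum>i\<in>Cm. m i *\<^sub>R column i A) = - (\<Sum>i\<in>Cm. \<bar>m i\<bar> *\<^sub>R column i A)"
      unfolding sum_negf[symmetric] by (intro sum.cong) (auto simp: Cm_def)
    finally show ?thesis by simp
  qed
  ultimately have "signed_circuit A Cp Cm"
    using circ unfolding signed_circuit_def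
    by (intro conjI exI[of _ "\<lambda>i. \<bar>m i\<bar>"]) (auto simp: Cp_def Cm_def)
  moreover have "Cp \<subseteq> {i. l i > 0}" "Cm \<subseteq> {i. l i < 0}"
    using Pm by (auto simp: P_def Cp_def Cm_def)
  ultimately show ?thesis by blast
qed

text \<open>The difference of the two representations is positive only on \<open>S1\<close> and
  negative only on \<open>S2\<close>. An index of \<open>S1\<close> outside \<open>S2\<close> makes
  it non-zero, and a circuit conformal to it violates proper intersection.\<close>

lemma intersect_properly_coeffs_eq:
  fixes A :: "real ^ 'n::finite ^ 'r::finite"
  assumes proper: "intersect_properly A S1 S2"
    and eq: "(\<Sum>i\<in>S1. u i *\<^sub>R column i A) = (\<Sum>i\<in>S2. v i *\<^sub>R column i A)"
    and pos: "\<And>i. i \<in> S1 \<Longrightarrow> u i > 0" "\<And>i. i \<in> S2 \<Longrightarrow> v i \<ge> 0"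
  shows "S1 \<subseteq> S2"
proof (rule ccontr)
  assume "\<not> S1 \<subseteq> S2"
  then obtain i0 where i0: "i0 \<in> S1" "i0 \<notin> S2" by blast
  define l where "l i = (if i \<in> S1 then u i else 0) - (if i \<in> S2 then v i else 0)" for i
  have "(\<Sum>i\<in>UNIV. (if i \<in> S1 then u i else 0) *\<^sub>R column i A) = (\<Sum>i\<in>S1. u i *\<^sub>R column i A)"
    by (rule sum.mono_neutral_cong_right) auto
  moreover have "(\<Sum>i\<in>UNIV. (if i \<in> S2 then v i else 0) *\<^sub>R column i A) = (\<Sum>i\<in>S2. v i *\<^sub>R column i A)"
    by (rule sum.mono_neutral_cong_right) auto
  ultimately have "(\<Sum>i\<in>UNIV. l i *\<^sub>R column i A) = 0"
    using eq by (simp add: l_def scaleR_left_diff_distrib sum_subtractf)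
  moreover have "l i0 \<noteq> 0" using i0 pos(1)[of i0] by (simp add: l_def)
  ultimately obtain Cp Cm where C: "signed_circuit A Cp Cm" "Cp \<subseteq> {i. l i > 0}" "Cm \<subseteq> {i. l i < 0}"
    using conformal_circuit by blast
  have "{i. l i > 0} \<subseteq> S1" "{i. l i < 0} \<subseteq> S2"
    using pos by (force simp: l_def split: if_splits)+
  with C proper show False unfolding intersect_properly_def by blast
qed

section \<open>Dual bases of simplices\<close>

lemma simplex_span:
  fixes A :: "real ^ 'n::finite ^ 'r::finite"
  assumes "is_simplex A S"
  shows "span ((\<lambda>i. column i A) ` S) = UNIV"
  using assms by (simp add: is_simplex_def subrank_def dim_eq_full[symmetric])

lemma simplex_inj:
  fixes A :: "real ^ 'n::finite ^ 'r::finite"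
  assumes "is_simplex A S"
  shows "inj_on (\<lambda>i. column i A) S"
proof (rule eq_card_imp_inj_on)
  have "card S = dim ((\<lambda>i. column i A) ` S)" using assms by (simp add: is_simplex_def subrank_def)
  also have "\<dots> \<le> card ((\<lambda>i. column i A) ` S)" by (rule dim_le_card') auto
  finally show "card ((\<lambda>i. column i A) ` S) = card S"
    using card_image_le[of S "\<lambda>i. column i A"] by simp
qed auto

lemma orthogonal_to_simplex:
  fixes A :: "real ^ 'n::finite ^ 'r::finite"
  assumes S: "is_simplex A S" and c: "\<And>i. i \<in> S \<Longrightarrow> c \<bullet> column i A = 0"
  shows "c = 0"
proof -
  have "c \<in> span ((\<lambda>i. column i A) ` S)" using simplex_span[OF S] by simp
  then have "orthogonal c c"
    by (rule orthogonal_to_span) (auto simp: orthogonal_def c)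
  then show ?thesis by (simp add: orthogonal_def)
qed

text \<open>For a simplex \<open>S\<close> these vectors form the basis dual to its columns; the
  inner product with the one at \<open>i \<in> S\<close> reads off the coordinate at
  \<open>i\<close>.\<close>

definition dual_vector :: "real ^ 'n::finite ^ 'r::finite \<Rightarrow> 'n set \<Rightarrow> 'n \<Rightarrow> real ^ 'r" where
  "dual_vector A S i = (SOME c. \<forall>j\<in>S. c \<bullet> column j A = (if j = i then 1 else 0))"

text \<open>The columns other than \<open>i\<close> span a proper subspace, so some non-zero
  \<open>c\<close> is orthogonal to them. It is not orthogonal to column \<open>i\<close> as well,
  because the simplex spans the space, and can be rescaled.\<close>

lemma dual_vector:
  fixes A :: "real ^ 'n::finite ^ 'r::finite"
  assumes S: "is_simplex A S" and i: "i \<in> S" and j: "j \<in> S"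
  shows "dual_vector A S i \<bullet> column j A = (if j = i then 1 else 0)"
proof -
  let ?F = "(\<lambda>i. column i A) ` (S - {i})"
  have "dim ?F \<le> card ?F" by (rule dim_le_card') auto
  also have "\<dots> \<le> card (S - {i})" by (rule card_image_le) auto
  also have "\<dots> < card S" using i by (intro psubset_card_mono) auto
  finally have "dim ?F < DIM(real ^ 'r)" using S by (simp add: is_simplex_def)
  then obtain c where c: "c \<noteq> 0" "\<And>y. y \<in> span ?F \<Longrightarrow> orthogonal c y"
    using orthogonal_to_subspace_exists[of ?F] by blast
  have c0: "c \<bullet> column k A = 0" if "k \<in> S" "k \<noteq> i" for k
    using c(2)[OF span_base, of "column k A"] that by (auto simp: orthogonal_def)
  then have ci: "c \<bullet> column i A \<noteq> 0"
    using orthogonal_to_simplex[OF S, of c] c(1) by metis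
  have "\<forall>k\<in>S. ((1 / (c \<bullet> column i A)) *\<^sub>R c) \<bullet> column k A = (if k = i then 1 else 0)"
    using c0 ci by auto
  then have "\<forall>k\<in>S. dual_vector A S i \<bullet> column k A = (if k = i then 1 else 0)"
    unfolding dual_vector_def by (rule someI)
  then show ?thesis using j by blast
qed

lemma dual_vector_combination:
  fixes A :: "real ^ 'n::finite ^ 'r::finite"
  assumes S: "is_simplex A S" and i: "i \<in> S"
  shows "dual_vector A S i \<bullet> (\<Sum>j\<in>S. u j *\<^sub>R column j A) = u i"
proof -
  have "dual_vector A S i \<bullet> (\<Sum>j\<in>S. u j *\<^sub>R column j A) = (\<Sum>j\<in>S. if j = i then u j else 0)"
    unfolding inner_sum_right by (intro sum.cong) (auto simp: dual_vector[OF S i])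
  then show ?thesis using i by simp
qed

lemma dual_vector_expansion:
  fixes A :: "real ^ 'n::finite ^ 'r::finite"
  assumes S: "is_simplex A S"
  shows "(\<Sum>i\<in>S. (dual_vector A S i \<bullet> q) *\<^sub>R column i A) = q"
proof -
  have "q \<in> span ((\<lambda>i. column i A) ` S)" using simplex_span[OF S] by simp
  then obtain u where "q = (\<Sum>v\<in>(\<lambda>i. column i A) ` S. u v *\<^sub>R v)"
    by (auto simp: span_finite)
  then have q: "q = (\<Sum>i\<in>S. u (column i A) *\<^sub>R column i A)"
    by (simp add: sum.reindex[OF simplex_inj[OF S]])
  with dual_vector_combination[OF S, of _ "\<lambda>i. u (column i A)"]
  have "dual_vector A S i \<bullet> q = u (column i A)" if "i \<in> S" for i using that by simp
  then have "(\<Sum>i\<in>S. (dual_vector A S i \<bullet> q) *\<^sub>R column i A) = (\<Sum>i\<in>S. u (column i A) *\<^sub>R column i A)"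
    by (intro sum.cong) auto
  also have "\<dots> = q" using q by simp
  finally show ?thesis .
qed

section \<open>Simplicial cones\<close>

text \<open>For a simplex, the set of strictly positive combinations of its columns. Stating it by
  dual coordinates presents the cone as an intersection of half-spaces, which makes its topology
  immediate.\<close>

definition open_cone :: "real ^ 'n::finite ^ 'r::finite \<Rightarrow> 'n set \<Rightarrow> (real ^ 'r) set" where
  "open_cone A S = {q. \<forall>i\<in>S. dual_vector A S i \<bullet> q > 0}"

definition closed_cone :: "real ^ 'n::finite ^ 'r::finite \<Rightarrow> 'n set \<Rightarrow> (real ^ 'r) set" where
  "closed_cone A S = {q. \<forall>i\<in>S. dual_vector A S i \<bullet> q \<ge> 0}"

lemma open_open_cone: "open (open_cone A S)"
proof -
  have "open_cone A S = (\<Inter>i\<in>S. {q. dual_vector A S i \<bullet> q > 0})" by (auto simp: open_cone_def)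
  then show ?thesis by (auto intro!: open_INT open_halfspace_gt finite)
qed

lemma closed_closed_cone: "closed (closed_cone A S)"
proof -
  have "closed_cone A S = (\<Inter>i\<in>S. {q. dual_vector A S i \<bullet> q \<ge> 0})" by (auto simp: closed_cone_def)
  then show ?thesis by (auto intro!: closed_INT closed_halfspace_ge)
qed

lemma open_cone_nonempty:
  fixes A :: "real ^ 'n::finite ^ 'r::finite"
  assumes S: "is_simplex A S"
  shows "open_cone A S \<noteq> {}"
proof -
  have "(\<Sum>j\<in>S. 1 *\<^sub>R column j A) \<in> open_cone A S"
    using dual_vector_combination[OF S, of _ "\<lambda>_. 1"] by (simp add: open_cone_def)
  then show ?thesis by blast
qed

lemma open_cone_subset: "open_cone A S \<subseteq> closed_cone A S"
  by (auto simp: open_cone_def closed_cone_def less_imp_le)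

text \<open>The dual coordinates of \<open>q\<close> give a strictly positive representation on
  \<open>S\<close> and a non-negative one on \<open>S'\<close>. Proper intersection yields
  \<open>S \<subseteq> S'\<close>, and equal cardinality does the rest.\<close>

lemma cones_meet_imp_eq:
  fixes A :: "real ^ 'n::finite ^ 'r::finite"
  assumes S: "is_simplex A S" "is_simplex A S'" and proper: "S = S' \<or> intersect_properly A S S'"
    and q: "q \<in> open_cone A S" "q \<in> closed_cone A S'"
  shows "S = S'"
  using proper
proof
  assume "intersect_properly A S S'"
  then have "S \<subseteq> S'"
    by (rule intersect_properly_coeffs_eq[where u = "\<lambda>i. dual_vector A S i \<bullet> q"
          and v = "\<lambda>i. dual_vector A S' i \<bullet> q"])
       (use q in \<open>auto simp: dual_vector_expansion S open_cone_def closed_cone_def\<close>)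
  then show ?thesis using S by (intro card_subset_eq) (auto simp: is_simplex_def)
qed

section \<open>Boundary facets and crossing of interior facets\<close>

text \<open>The zero set of the dual vector at \<open>j\<close> is a cocircuit containing the facet.
  As the facet is not interior and \<open>j\<close> lies on the positive side, the negative side is
  empty, so the whole configuration lies in one closed half-space.\<close>

lemma boundary_facet_positive:
  fixes A :: "real ^ 'n::finite ^ 'r::finite"
  assumes S: "is_simplex A S" and j: "j \<in> S" and bd: "\<not> interior_facet A (S - {j})"
    and S': "is_simplex A S'" and q: "q \<in> open_cone A S'"
  shows "dual_vector A S j \<bullet> q > 0"
proof -
  define c where "c = dual_vector A S j"
  define Z where "Z = {i. c \<bullet> column i A = 0}"
  have cj: "c \<bullet> column j A = 1" using dual_vector[OF S j j] by (simp add: c_def)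
  then have cnz: "c \<noteq> 0" by auto
  have FZ: "S - {j} \<subseteq> Z" using dual_vector[OF S j] by (auto simp: Z_def c_def)
  have "subrank A Z < CARD('r)"
  proof -
    have "span ((\<lambda>i. column i A) ` Z) \<noteq> UNIV"
    proof
      assume "span ((\<lambda>i. column i A) ` Z) = UNIV"
      then have "orthogonal c c"
        by (intro orthogonal_to_span[of c "(\<lambda>i. column i A) ` Z"]) (auto simp: orthogonal_def Z_def)
      then show False using cnz by (simp add: orthogonal_def)
    qed
    then have "subrank A Z \<noteq> DIM(real ^ 'r)" unfolding subrank_def dim_eq_full .
    then show ?thesis
      using dim_subset_UNIV[of "(\<lambda>i. column i A) ` Z"] by (simp add: subrank_def)
  qed
  \<comment> \<open>Expanding a column \<open>k\<close> off the hyperplane in the basis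
    \<open>S\<close> expresses column \<open>j\<close> by column \<open>k\<close> and the facet, so
    any proper superset of \<open>Z\<close> has full rank.\<close>
  moreover have "\<not> subrank A Z' < CARD('r)" if Z': "Z \<subset> Z'" for Z'
  proof -
    from Z' obtain k where k: "k \<in> Z'" "c \<bullet> column k A \<noteq> 0" by (auto simp: Z_def)
    let ?V = "span ((\<lambda>i. column i A) ` Z')"
    have F: "column i A \<in> ?V" if "i \<in> S" "i \<noteq> j" for i
      using that FZ Z' by (intro span_base) auto
    have "column k A = (\<Sum>i\<in>S. (dual_vector A S i \<bullet> column k A) *\<^sub>R column i A)"
      by (simp add: dual_vector_expansion[OF S])
    also have "\<dots> = (c \<bullet> column k A) *\<^sub>R column j A +
        (\<Sum>i\<in>S-{j}. (dual_vector A S i \<bullet> column k A) *\<^sub>R column i A)"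
      using j by (subst sum.remove[of _ j]) (auto simp: c_def)
    finally have "(c \<bullet> column k A) *\<^sub>R column j A =
        column k A - (\<Sum>i\<in>S-{j}. (dual_vector A S i \<bullet> column k A) *\<^sub>R column i A)"
      by (simp add: algebra_simps)
    also have "\<dots> \<in> ?V"
      using k(1) by (intro span_diff[OF span_base] span_sum span_scale F imageI) auto
    finally have "(1 / (c \<bullet> column k A)) *\<^sub>R ((c \<bullet> column k A) *\<^sub>R column j A) \<in> ?V"
      by (rule span_scale)
    then have "column j A \<in> ?V" using k(2) by simp
    with F have "(\<lambda>i. column i A) ` S \<subseteq> ?V" by auto
    then have "?V = UNIV" using simplex_span[OF S] span_minimal[OF _ subspace_span] by blast
    then have "dim ((\<lambda>i. column i A) ` Z') = DIM(real ^ 'r)" unfolding dim_eq_full .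
    then show ?thesis by (simp add: subrank_def)
  qed
  ultimately have "cocircuit A Z" by (auto simp: cocircuit_def)
  then have sc: "signed_cocircuit A Z {i. c \<bullet> column i A > 0} {i. - (c \<bullet> column i A) > 0}"
    using cnz unfolding signed_cocircuit_def by (auto simp: Z_def intro!: exI[of _ c])
  have "facet_of_simplex A (S - {j}) S"
    using S j by (auto simp: facet_of_simplex_def is_simplex_def)
  with sc FZ bd have "{i. c \<bullet> column i A > 0} = {} \<or> {i. - (c \<bullet> column i A) > 0} = {}"
    unfolding interior_facet_def by blast
  moreover have "j \<in> {i. c \<bullet> column i A > 0}" using cj by simp
  ultimately have "{i. - (c \<bullet> column i A) > 0} = {}" by blast
  then have nn: "c \<bullet> column i A \<ge> 0" for i by (auto simp: not_less)
  have qp: "dual_vector A S' i \<bullet> q > 0" if "i \<in> S'" for i using q that by (auto simp: open_cone_def)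
  \<comment> \<open>The columns of \<open>S'\<close> span the space, so \<open>c\<close> cannot
    vanish on all of them; this makes the sum strictly positive.\<close>
  obtain i where i: "i \<in> S'" "c \<bullet> column i A \<noteq> 0"
    using orthogonal_to_simplex[OF S', of c] cnz by blast
  have "c \<bullet> q = c \<bullet> (\<Sum>i\<in>S'. (dual_vector A S' i \<bullet> q) *\<^sub>R column i A)"
    by (simp add: dual_vector_expansion[OF S'])
  also have "\<dots> = (\<Sum>i\<in>S'. (dual_vector A S' i \<bullet> q) * (c \<bullet> column i A))"
    by (simp add: inner_sum_right)
  also have "\<dots> > 0"
  proof (rule sum_pos2[of _ i])
    show "0 < dual_vector A S' i \<bullet> q * (c \<bullet> column i A)"
      using i nn[of i] qp[of i] by (simp add: less_le)
    show "0 \<le> dual_vector A S' i \<bullet> q * (c \<bullet> column i A)" if "i \<in> S'" for i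
      using nn qp that by (intro mult_nonneg_nonneg less_imp_le[OF qp])
  qed (use i in auto)
  finally show ?thesis by (simp add: c_def)
qed

text \<open>Near \<open>p\<close> the coordinates at the common facet stay positive for both
  simplices, and the remaining coordinate of each is a multiple of \<open>c \<bullet> q\<close>. The
  simplices lie on opposite sides of the facet, so the two cones cover both sides.\<close>

lemma adjacent_cones_neighbourhood:
  fixes A :: "real ^ 'n::finite ^ 'r::finite"
  assumes S: "is_simplex A S" "is_simplex A S'" and ne: "S \<noteq> S'"
    and proper: "intersect_properly A S S'"
    and j: "j \<in> S" "S - {j} \<subseteq> S'"
    and pF: "\<And>i. i \<in> S - {j} \<Longrightarrow> dual_vector A S i \<bullet> p > 0" and pj: "dual_vector A S j \<bullet> p = 0"
  shows "p \<in> interior (closed_cone A S \<union> closed_cone A S')"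
proof -
  define c where "c = dual_vector A S j"
  let ?d = "dual_vector A S" and ?d' = "dual_vector A S'"
  have card: "card (S - {j}) < card S'" using S j(1)
    by (metis card_Diff1_less finite is_simplex_def)
  then have "S' \<noteq> S - {j}" by auto
  with j obtain k where k: "k \<in> S'" "k \<notin> S - {j}" by blast
  have "card (insert k (S - {j})) = card S'"
    using S j(1) k(2) by (simp add: is_simplex_def)
  then have S'eq: "insert k (S - {j}) = S'"
    using k j(2) by (intro card_subset_eq) auto
  have cF: "c \<bullet> column i A = 0" if "i \<in> S - {j}" for i
    using dual_vector[OF S(1) j(1)] that by (auto simp: c_def)
  have cj: "c \<bullet> column j A = 1" using dual_vector[OF S(1) j(1) j(1)] by (simp add: c_def)
  \<comment> \<open>All columns of \<open>S'\<close> except \<open>k\<close> lie in the hyperplane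
    of the facet, so \<open>c\<close> is proportional to the dual vector of \<open>S'\<close> at
    \<open>k\<close>.\<close>
  have cq: "c \<bullet> q = (?d' k \<bullet> q) * (c \<bullet> column k A)" for q
  proof -
    have "c \<bullet> q = c \<bullet> (\<Sum>i\<in>S'. (?d' i \<bullet> q) *\<^sub>R column i A)"
      by (simp add: dual_vector_expansion[OF S(2)])
    also have "\<dots> = (\<Sum>i\<in>S'. (?d' i \<bullet> q) * (c \<bullet> column i A))"
      by (simp add: inner_sum_right)
    also have "\<dots> = (?d' k \<bullet> q) * (c \<bullet> column k A) + (\<Sum>i\<in>S-{j}. (?d' i \<bullet> q) * (c \<bullet> column i A))"
      using k(2) unfolding S'eq[symmetric] by (subst sum.insert) auto
    also have "(\<Sum>i\<in>S-{j}. (?d' i \<bullet> q) * (c \<bullet> column i A)) = 0"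
      by (rule sum.neutral) (simp add: cF)
    finally show ?thesis by simp
  qed
  have ck0: "c \<bullet> column k A \<noteq> 0" using cq[of "column j A"] cj by auto
  \<comment> \<open>The point \<open>p\<close> lies in the span of the common facet, so both bases
    give it the same coordinates there.\<close>
  have pS': "?d' i \<bullet> p = ?d i \<bullet> p" if i: "i \<in> S - {j}" for i
  proof -
    have "p = (\<Sum>i\<in>S. (?d i \<bullet> p) *\<^sub>R column i A)" by (simp add: dual_vector_expansion[OF S(1)])
    also have "\<dots> = (\<Sum>i\<in>S-{j}. (?d i \<bullet> p) *\<^sub>R column i A)"
      using j(1) pj by (subst sum.remove[of _ j]) auto
    also have "\<dots> = (\<Sum>i\<in>S'. (if i = k then 0 else ?d i \<bullet> p) *\<^sub>R column i A)"
    proof -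
      have "(\<Sum>i\<in>S-{j}. (?d i \<bullet> p) *\<^sub>R column i A) =
          (\<Sum>i\<in>S-{j}. (if i = k then 0 else ?d i \<bullet> p) *\<^sub>R column i A)"
        using k(2) by (intro sum.cong) auto
      then show ?thesis using k(2) unfolding S'eq[symmetric] by (subst sum.insert) auto
    qed
    finally have "?d' i \<bullet> p = ?d' i \<bullet> \<dots>" by simp
    also have "\<dots> = (if i = k then 0 else ?d i \<bullet> p)"
      using i j(2) by (intro dual_vector_combination[OF S(2)]) auto
    finally show ?thesis using i k(2) by auto
  qed
  define N where "N = (\<Inter>i\<in>S-{j}. {q. ?d i \<bullet> q > 0} \<inter> {q. ?d' i \<bullet> q > 0})"
  have oN: "open N" unfolding N_def by (auto intro!: open_INT open_Int open_halfspace_gt finite)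
  have pN: "p \<in> N" using pF pS' by (auto simp: N_def)
  \<comment> \<open>If both simplices were on the same side, a small step from \<open>p\<close>
    towards column \<open>j\<close> would enter the open cone of \<open>S\<close> and the cone of
    \<open>S'\<close> together, forcing \<open>S = S'\<close>.\<close>
  have "c \<bullet> column k A < 0"
  proof (rule ccontr)
    assume "\<not> c \<bullet> column k A < 0"
    with ck0 have ck: "c \<bullet> column k A > 0" by simp
    have "((\<lambda>e. p + e *\<^sub>R column j A) \<longlongrightarrow> p + 0 *\<^sub>R column j A) (at_right 0)"
      by (intro tendsto_intros)
    then have "\<forall>\<^sub>F e in at_right 0. p + e *\<^sub>R column j A \<in> N"
      using oN pN by (auto dest: topological_tendstoD)
    moreover have "\<forall>\<^sub>F e in at_right (0::real). e > 0" by (simp add: eventually_at_right_less)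
    ultimately have "\<forall>\<^sub>F e in at_right 0. p + e *\<^sub>R column j A \<in> N \<and> e > 0"
      by (rule eventually_conj)
    then obtain e where e: "p + e *\<^sub>R column j A \<in> N" "e > 0"
      using eventually_happens[of _ "at_right (0::real)"] by (auto simp: trivial_limit_at_right_real)
    let ?q = "p + e *\<^sub>R column j A"
    have ce: "c \<bullet> ?q = e" using pj cj by (simp add: c_def inner_add_right)
    have "?q \<in> open_cone A S"
      using e ce by (auto simp: open_cone_def N_def c_def)
    moreover have "?d' k \<bullet> ?q > 0" using cq[of ?q] ce e(2) ck by (metis zero_less_mult_pos2)
    then have "?q \<in> closed_cone A S'"
      using e(1) unfolding closed_cone_def N_def S'eq[symmetric] by (auto intro: less_imp_le)
    ultimately show False using cones_meet_imp_eq[OF S] proper ne by blast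
  qed
  have "N \<subseteq> closed_cone A S \<union> closed_cone A S'"
  proof
    fix q assume q: "q \<in> N"
    show "q \<in> closed_cone A S \<union> closed_cone A S'"
    proof (cases "c \<bullet> q \<ge> 0")
      case True
      then have "q \<in> closed_cone A S"
        using q unfolding closed_cone_def N_def c_def by (auto intro: less_imp_le)
      then show ?thesis ..
    next
      case False
      then have "?d' k \<bullet> q \<ge> 0"
        using cq[of q] \<open>c \<bullet> column k A < 0\<close> by (auto simp: not_le mult_less_0_iff)
      then have "q \<in> closed_cone A S'"
        using q unfolding closed_cone_def N_def S'eq[symmetric] by (auto intro: less_imp_le)
      then show ?thesis ..
    qed
  qed
  then show ?thesis using interior_maximal[OF _ oN] pN by blast
qed

section \<open>Maximality of triangulations\<close>

text \<open>
  The segment from \<open>y\<close> to \<open>x\<close> meets the span of \<open>G\<close> outside \<open>y\<close> only if \<open>x\<close> lies in the span of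
  \<open>G\<close> and \<open>y\<close>, which has codimension at least one.
\<close>
lemma generic_point:
  fixes A :: "real ^ 'n::finite ^ 'r::finite"
  assumes U: "open U" "U \<noteq> {}"
  obtains x where "x \<in> U"
    "\<And>G. card G + 2 \<le> CARD('r) \<Longrightarrow> x \<notin> span (insert y ((\<lambda>i. column i A) ` G))"
proof -
  define B where "B = (\<Union>G\<in>{G. card G + 2 \<le> CARD('r)}. span (insert y ((\<lambda>i. column i A) ` G)))"
  have "negligible (span (insert y ((\<lambda>i. column i A) ` G)))" if G: "card G + 2 \<le> CARD('r)" for G
  proof (rule negligible_lowdim)
    have "dim (insert y ((\<lambda>i. column i A) ` G)) \<le> card (insert y ((\<lambda>i. column i A) ` G))"
      by (rule dim_le_card') auto
    also have "\<dots> \<le> Suc (card ((\<lambda>i. column i A) ` G))" by (rule card_insert_le_m1) auto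
    also have "\<dots> \<le> Suc (card G)" by (simp add: card_image_le)
    finally show "dim (span (insert y ((\<lambda>i. column i A) ` G))) < DIM(real ^ 'r)"
      using G by simp
  qed
  then have "negligible B" unfolding B_def by (intro negligible_Union) auto
  then have "\<not> U \<subseteq> B" using open_not_negligible[OF U] negligible_subset by blast
  then show ?thesis using that by (auto simp: B_def)
qed

text \<open>The cones of \<open>T\<close> reach a point in the open cone of \<open>S0\<close>, and
  the member whose cone contains this point must be \<open>S0\<close> itself.\<close>

lemma triangulation_maximal:
  fixes A :: "real ^ 'n::finite ^ 'r::finite"
  assumes T: "is_triangulation A T" and S0: "is_simplex A S0"
    and proper: "\<And>S. S \<in> T \<Longrightarrow> S0 = S \<or> intersect_properly A S0 S"
  shows "S0 \<in> T"
proof -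
  have simp: "is_simplex A S" if "S \<in> T" for S using T that by (auto simp: is_triangulation_def)
  obtain S1 where S1: "S1 \<in> T" using T by (auto simp: is_triangulation_def)
  obtain y where y: "y \<in> open_cone A S1" using open_cone_nonempty[OF simp[OF S1]] by blast
  obtain x where x: "x \<in> open_cone A S0" and
    gen: "\<And>G. card G + 2 \<le> CARD('r) \<Longrightarrow> x \<notin> span (insert y ((\<lambda>i. column i A) ` G))"
    using generic_point[OF open_open_cone open_cone_nonempty[OF S0]] by blast
  define K where "K = (\<Union>S\<in>T. closed_cone A S)"
  define p where "p t = (1 - t) *\<^sub>R y + t *\<^sub>R x" for t :: real
  have contp: "continuous_on {0..1} p" unfolding p_def by (intro continuous_intros)
  have closedK: "closed K" unfolding K_def by (intro closed_UN) (auto simp: closed_closed_cone)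
  have open_cone_interior: "open_cone A S \<subseteq> interior K" if "S \<in> T" for S
    using that open_cone_subset by (intro interior_maximal[OF _ open_open_cone]) (auto simp: K_def)
  \<comment> \<open>The key claim: the segment cannot leave \<open>K\<close>, because each of its
    points in \<open>K\<close> is interior to \<open>K\<close>.\<close>
  have int: "p t \<in> interior K" if t: "t \<in> {0..1}" and ptK: "p t \<in> K" for t
  proof (cases "t = 0")
    case True
    then show ?thesis using y open_cone_interior[OF S1] by (auto simp: p_def)
  next
    case False
    with t have tpos: "t > 0" by simp
    from ptK obtain S where S: "S \<in> T" "p t \<in> closed_cone A S" by (auto simp: K_def)
    note sS = simp[OF S(1)]
    let ?d = "dual_vector A S"
    \<comment> \<open>The vertices of the smallest face of \<open>S\<close> whose cone contains
      \<open>p t\<close>. By genericity of \<open>x\<close> at most one vertex of \<open>S\<close>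
      is missing from it.\<close>
    define G where "G = {i \<in> S. ?d i \<bullet> p t > 0}"
    have "G \<subseteq> S" by (auto simp: G_def)
    have z: "?d i \<bullet> p t = 0" if "i \<in> S - G" for i
      using that S(2) by (force simp: G_def closed_cone_def)
    have "p t = (\<Sum>i\<in>S. (?d i \<bullet> p t) *\<^sub>R column i A)" by (simp add: dual_vector_expansion[OF sS])
    also have "\<dots> = (\<Sum>i\<in>G. (?d i \<bullet> p t) *\<^sub>R column i A)"
      using z by (intro sum.mono_neutral_right) (auto simp: G_def)
    also have "\<dots> \<in> span (insert y ((\<lambda>i. column i A) ` G))"
      by (intro span_sum span_scale) (auto intro: span_base)
    finally have "p t - (1 - t) *\<^sub>R y \<in> span (insert y ((\<lambda>i. column i A) ` G))"
      by (intro span_diff span_scale) (auto intro: span_base)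
    then have "t *\<^sub>R x \<in> span (insert y ((\<lambda>i. column i A) ` G))" by (simp add: p_def)
    then have "(1 / t) *\<^sub>R (t *\<^sub>R x) \<in> span (insert y ((\<lambda>i. column i A) ` G))" by (rule span_scale)
    then have "x \<in> span (insert y ((\<lambda>i. column i A) ` G))" using tpos by simp
    then have "\<not> card G + 2 \<le> card S" using gen[of G] sS by (auto simp: is_simplex_def)
    moreover have "card S = card G + card (S - G)"
      by (rule card_Int_Diff[of S G, unfolded Int_absorb1[OF \<open>G \<subseteq> S\<close>]]) simp
    ultimately have "card (S - G) \<le> 1" by simp
    then have "card (S - G) = 0 \<or> card (S - G) = 1" by linarith
    then consider "S - G = {}" | j where "S - G = {j}"
      by (auto simp: card_1_singleton_iff simp del: Diff_eq_empty_iff)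
    then show ?thesis
    proof cases
      case 1
      then have "p t \<in> open_cone A S" by (auto simp: open_cone_def G_def)
      then show ?thesis using open_cone_interior[OF S(1)] by blast
    next
      case 2
      then have j: "j \<in> S" "S - {j} = G" and pj: "?d j \<bullet> p t = 0"
        using z[of j] \<open>G \<subseteq> S\<close> by blast+
      have "interior_facet A (S - {j})"
      proof (rule ccontr)
        assume nb: "\<not> interior_facet A (S - {j})"
        note pos = boundary_facet_positive[OF sS j(1) nb]
        have "?d j \<bullet> y > 0" "?d j \<bullet> x > 0"
          by (rule pos[OF simp[OF S1] y], rule pos[OF S0 x])
        then have "?d j \<bullet> p t > 0"
          using t tpos by (auto simp: p_def inner_add_right intro!: add_nonneg_pos)
        with pj show False by simp
      qed
      moreover have "facet_of_simplex A (S - {j}) S"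
        using sS j(1) by (auto simp: facet_of_simplex_def is_simplex_def)
      ultimately obtain S' where S': "S' \<in> T" "S' \<noteq> S" "S - {j} \<subseteq> S'"
        using T S(1) unfolding is_triangulation_def by blast
      moreover have "intersect_properly A S S'"
        using T S(1) S' by (auto simp: is_triangulation_def pairwise_def)
      ultimately have "p t \<in> interior (closed_cone A S \<union> closed_cone A S')"
        using sS simp[OF S'(1)] j pj by (intro adjacent_cones_neighbourhood[where j = j]) (auto simp: G_def)
      moreover have "closed_cone A S \<union> closed_cone A S' \<subseteq> K"
        using S(1) S'(1) by (auto simp: K_def)
      ultimately show ?thesis using interior_mono by blast
    qed
  qed
  \<comment> \<open>The parameters at which the segment is in \<open>K\<close> form a set that is
    relatively closed, relatively open by the claim, and contains \<open>0\<close>; connectedness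
    gives the whole interval.\<close>
  let ?E = "{0..1} \<inter> p -` K"
  have "?E = {0..1} \<inter> p -` interior K"
    using int subsetD[OF interior_subset[of K]] by auto
  then have "openin (top_of_set {0..1}) ?E"
    using continuous_openin_preimage_gen[OF contp open_interior] by simp
  moreover have "closedin (top_of_set {0..1}) ?E"
    using continuous_closedin_preimage[OF contp closedK] .
  ultimately have "?E = {} \<or> ?E = {0..1}"
    using connected_Icc[of "0::real" 1] unfolding connected_clopen by simp
  moreover have "0 \<in> ?E" using y S1 open_cone_subset by (auto simp: p_def K_def)
  ultimately have "?E = {0..1}" by blast
  then have "1 \<in> ?E" by (metis atLeastAtMost_iff order_refl zero_le_one)
  then have "x \<in> K" by (simp add: p_def)
  then obtain S where "S \<in> T" "x \<in> closed_cone A S" by (auto simp: K_def)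
  then show ?thesis using cones_meet_imp_eq[OF S0 simp proper x] by blast
qed

section \<open>Automorphisms preserve simplices\<close>

text \<open>Automorphisms are specified through signed circuits alone, so dependence has to be
  phrased in these terms before it can be transported.\<close>

lemma cols_dependent_iff_signed_circuit:
  fixes A :: "real ^ 'n::finite ^ 'r::finite"
  shows "cols_dependent A I \<longleftrightarrow> (\<exists>Cp Cm. signed_circuit A Cp Cm \<and> Cp \<union> Cm \<subseteq> I)"
proof
  assume "cols_dependent A I"
  then obtain l i where l: "i \<in> I" "l i \<noteq> 0" "(\<Sum>i\<in>I. l i *\<^sub>R column i A) = 0"
    by (auto simp: cols_dependent_def)
  define m where "m i = (if i \<in> I then l i else 0)" for i
  have "(\<Sum>i\<in>UNIV. m i *\<^sub>R column i A) = (\<Sum>i\<in>I. l i *\<^sub>R column i A)"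
    by (rule sum.mono_neutral_cong_right) (auto simp: m_def)
  with l have "(\<Sum>i\<in>UNIV. m i *\<^sub>R column i A) = 0" "m i \<noteq> 0" by (auto simp: m_def)
  then obtain Cp Cm where C: "signed_circuit A Cp Cm" "Cp \<subseteq> {i. m i > 0}" "Cm \<subseteq> {i. m i < 0}"
    using conformal_circuit by blast
  moreover have "{i. m i > 0} \<subseteq> I" "{i. m i < 0} \<subseteq> I" by (auto simp: m_def split: if_splits)
  ultimately show "\<exists>Cp Cm. signed_circuit A Cp Cm \<and> Cp \<union> Cm \<subseteq> I" by blast
next
  assume "\<exists>Cp Cm. signed_circuit A Cp Cm \<and> Cp \<union> Cm \<subseteq> I"
  then obtain C where C: "cols_dependent A C" "C \<subseteq> I"
    by (auto simp: signed_circuit_def circuit_def)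
  then obtain l i where l: "i \<in> C" "l i \<noteq> 0" "(\<Sum>i\<in>C. l i *\<^sub>R column i A) = 0"
    by (auto simp: cols_dependent_def)
  have "(\<Sum>i\<in>I. (if i \<in> C then l i else 0) *\<^sub>R column i A) = (\<Sum>i\<in>C. l i *\<^sub>R column i A)"
    using C(2) by (intro sum.mono_neutral_cong_right) auto
  with l C(2) show "cols_dependent A I"
    unfolding cols_dependent_def by (intro exI[of _ "\<lambda>i. if i \<in> C then l i else 0"]) auto
qed

text \<open>Trades the rank condition for independence of the indexed family, which circuits
  detect.\<close>

lemma is_simplex_iff:
  fixes A :: "real ^ 'n::finite ^ 'r::finite"
  shows "is_simplex A S \<longleftrightarrow> card S = CARD('r) \<and> \<not> cols_dependent A S"
proof
  assume S: "is_simplex A S"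
  have "l i = 0" if "(\<Sum>i\<in>S. l i *\<^sub>R column i A) = 0" "i \<in> S" for l i
    using dual_vector_combination[OF S that(2), of l] that(1) by simp
  then show "card S = CARD('r) \<and> \<not> cols_dependent A S"
    using S by (auto simp: is_simplex_def cols_dependent_def)
next
  assume asm: "card S = CARD('r) \<and> \<not> cols_dependent A S"
  \<comment> \<open>Equal columns at two indices would be dependent with coefficients 1 and -1.
    Injectivity allows passing from the family to the set of columns.\<close>
  have inj: "inj_on (\<lambda>i. column i A) S"
  proof (rule inj_onI, rule ccontr)
    fix i j assume ij: "i \<in> S" "j \<in> S" "column i A = column j A" "i \<noteq> j"
    define l :: "'n \<Rightarrow> real" where "l k = (if k = i then 1 else if k = j then - 1 else 0)" for k
    have "(\<Sum>k\<in>S. l k *\<^sub>R column k A) = (\<Sum>k\<in>{i, j}. l k *\<^sub>R column k A)"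
      using ij by (intro sum.mono_neutral_right) (auto simp: l_def)
    also have "\<dots> = 0" using ij by (simp add: l_def)
    finally have "cols_dependent A S"
      using ij(1) unfolding cols_dependent_def by (intro exI[of _ l]) (auto simp: l_def)
    with asm show False by simp
  qed
  have "independent ((\<lambda>i. column i A) ` S)"
  proof
    assume "dependent ((\<lambda>i. column i A) ` S)"
    then obtain u where "\<exists>v\<in>(\<lambda>i. column i A) ` S. u v \<noteq> 0"
      "(\<Sum>v\<in>(\<lambda>i. column i A) ` S. u v *\<^sub>R v) = 0"
      by (auto simp: dependent_finite)
    then have "cols_dependent A S"
      unfolding cols_dependent_def
      by (intro exI[of _ "\<lambda>i. u (column i A)"]) (auto simp: sum.reindex[OF inj])
    with asm show False by simp
  qed
  then have "subrank A S = card ((\<lambda>i. column i A) ` S)"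
    unfolding subrank_def by (rule dim_eq_card_independent)
  then show "is_simplex A S" using asm by (simp add: is_simplex_def card_image[OF inj])
qed

text \<open>A signed circuit inside the image would pull back along \<sigma> to one inside
  \<open>S\<close>.\<close>

lemma automorphism_simplex:
  fixes A :: "real ^ 'n::finite ^ 'r::finite"
  assumes \<sigma>: "\<sigma> \<in> automorphisms A" and S: "is_simplex A S"
  shows "is_simplex A (\<sigma> ` S)"
proof -
  from \<sigma> have bij: "bij \<sigma>"
    and sc: "\<And>Cp Cm. signed_circuit A (\<sigma> ` Cp) (\<sigma> ` Cm) \<longleftrightarrow> signed_circuit A Cp Cm"
    by (auto simp: automorphisms_def)
  have "\<not> cols_dependent A (\<sigma> ` S)"
  proof
    assume "cols_dependent A (\<sigma> ` S)"
    then obtain Cp Cm where C: "signed_circuit A Cp Cm" "Cp \<union> Cm \<subseteq> \<sigma> ` S"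
      by (auto simp: cols_dependent_iff_signed_circuit)
    then have "Cp \<subseteq> \<sigma> ` S" "Cm \<subseteq> \<sigma> ` S" by auto
    then obtain Dp Dm where D: "Cp = \<sigma> ` Dp" "Cm = \<sigma> ` Dm" "Dp \<subseteq> S" "Dm \<subseteq> S"
      by (elim subset_imageE)
    with C sc have "cols_dependent A S"
      unfolding cols_dependent_iff_signed_circuit by (intro exI[of _ Dp] exI[of _ Dm]) auto
    with S show False by (simp add: is_simplex_iff)
  qed
  moreover have "card (\<sigma> ` S) = card S"
    using bij by (intro card_image) (auto simp: bij_def inj_on_def)
  ultimately show ?thesis using S by (simp add: is_simplex_iff)
qed

section \<open>Invariance under the group\<close>

theorem theorem14:
  fixes A :: "real ^ 'n::finite ^ 'r::finite"
    and H :: "('n \<Rightarrow> 'n) set"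
    and T :: "'n set set"
  assumes "point_configuration A"
    and "subgroup H (aut_group A)"
    and "T \<noteq> {}"
    and "\<forall>S\<in>T. feasible A H S"
    and "pairwise (orbits_intersect_properly A H) T"
    and "free_interior_facets A T = {}"
  shows "is_triangulation A T \<and> invariant H T"
proof -
  have aut: "\<sigma> \<in> automorphisms A" if "\<sigma> \<in> H" for \<sigma>
    using subgroup.subset[OF assms(2)] that by (auto simp: aut_group_def)
  have idH: "id \<in> H"
    using subgroup.one_closed[OF assms(2)]
    by (simp add: aut_group_def BijGroup_def id_def restrict_def)
  have orb: "S \<in> simplex_orbit H S" for S
    using imageI[OF idH, of "\<lambda>\<sigma>. \<sigma> ` S"] by (simp add: simplex_orbit_def)
  have simp: "is_simplex A S" if "S \<in> T" for S using assms(4) that by (auto simp: feasible_def)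
  have img: "\<sigma> ` S = S' \<or> intersect_properly A (\<sigma> ` S) S'"
    if "\<sigma> \<in> H" "S \<in> T" "S' \<in> T" for \<sigma> S S'
  proof -
    have \<sigma>S: "\<sigma> ` S \<in> simplex_orbit H S" using that(1) by (simp add: simplex_orbit_def)
    show ?thesis
    \<comment> \<open>Feasibility handles images of the same simplex; the pairwise hypothesis
      concerns distinct members only.\<close>
    proof (cases "S = S'")
      case True
      then have "feasible A H S'" using assms(4) that by simp
      then show ?thesis
        using \<sigma>S orb[of S'] True by (simp add: feasible_def)
    next
      case False
      then have "orbits_intersect_properly A H S S'"
        using assms(5) that by (simp add: pairwise_def)
      then show ?thesis using \<sigma>S orb[of S'] by (simp add: orbits_intersect_properly_def)
    qed
  qed
  \<comment> \<open>Proper intersection of distinct members is the case of the identity in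
    \<open>H\<close>; an interior facet of a member is not free, so a second member contains
    it.\<close>
  have tri: "is_triangulation A T"
    unfolding is_triangulation_def
  proof (intro conjI ballI allI impI)
    show "pairwise (intersect_properly A) T"
      using img[OF idH, unfolded image_id id_apply] by (simp add: pairwise_def) metis
    fix S F assume S: "S \<in> T" and F: "facet_of_simplex A F S \<and> interior_facet A F"
    then have "F \<subseteq> S" by (simp add: facet_of_simplex_def)
    moreover have "F \<notin> free_interior_facets A T" using assms(6) by simp
    then have "\<not> (\<exists>!S. S \<in> T \<and> F \<subseteq> S)"
      using F by (simp add: free_interior_facets_def)
    ultimately show "\<exists>S'\<in>T. S' \<noteq> S \<and> F \<subseteq> S'" using S by metis
  qed (use assms(3) simp in auto)
  moreover have "invariant H T"
    unfolding invariant_def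
  proof
    fix \<sigma> assume \<sigma>: "\<sigma> \<in> H"
    have "\<sigma> ` S \<in> T" if "S \<in> T" for S
      by (rule triangulation_maximal[OF tri automorphism_simplex[OF aut[OF \<sigma>] simp[OF that]] img[OF \<sigma> that]])
    then have "(\<lambda>S. \<sigma> ` S) ` T \<subseteq> T" by (rule image_subsetI)
    \<comment> \<open>As \<open>T\<close> is finite, an injective self-map of \<open>T\<close> is
      onto, which upgrades the inclusion to equality.\<close>
    moreover have "inj \<sigma>" using aut[OF \<sigma>] by (simp add: automorphisms_def bij_def)
    then have "inj_on (\<lambda>S. \<sigma> ` S) T" by (simp add: inj_on_def inj_image_eq_iff)
    ultimately show "(\<lambda>S. \<sigma> ` S) ` T = T" by (intro endo_inj_surj) auto
  qed
  ultimately show ?thesis ..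
qed

end
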